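(* Let $(X,\widehat d_X)$ and $(Y,\widehat d_Y)$ be two non-Archimedean metric spaces. (1) $\widehat\rho_u$ is a non-Archimedean metric on $\mathfrak M(X\to Y)$, i.e. $(\mathfrak M(X\to Y),\widehat\rho_u)$ is a non-Archimedean metric space. (2) For any $f,g\in\mathfrak M(X\to Y)$, $\widehat\rho_H(f,g)\le\widehat\rho_u(f,g)$. In particular, if both $f$ and $g$ are nonexpanding, then $\widehat\rho_H(f,g)=\widehat\rho_u(f,g)$. (3) For any $f,g\in\mathfrak M(X\to Y)$, $\widehat\rho_H(f,g)=\widehat\rho_b(f,g)$. In particular, if either $f$ or $g$ is a Lipschitz map, and $\min\{\operatorname{dil} f,\operatorname{dil} g\}\ge1$, then $$\widehat\rho_s(f,g)\le\min\{\operatorname{dil} f,\ \operatorname{dil} g\}\cdot\widehat\rho_H(f,g).$$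
   Context: Metrics may take the value $+\infty$, and $\inf\emptyset=+\infty$. A metric $\widehat d$ is non-Archimedean if $\widehat d(x,z)\le\max\{\widehat d(x,y),\widehat d(y,z)\}$ for all $x,y,z$. $\mathfrak M(X\to Y)$ is the set of all maps $X\to Y$. $B_x(r)=\{x'\in X:\widehat d_X(x,x')<r\}$. In a metric space $(Z,d)$, $\operatorname{dist}(x,A)=\inf_{a\in A}d(x,a)$ and $d_H(A,B)=\max\{\sup_{a\in A}\operatorname{dist}(a,B),\sup_{b\in B}\operatorname{dist}(b,A)\}$. On $Z=X\times Y$ use $\widehat d_Z((x_1,y_1),(x_2,y_2))=\max\{\widehat d_X(x_1,x_2),\widehat d_Y(y_1,y_2)\}$ with Hausdorff distance $\widehat d_{Z,H}$. For $f,g\in\mathfrak M(X\to Y)$, with graphs $\Gamma_f=\{(x,f(x)):x\in X\}$: - $\widehat\rho_H(f,g)=\widehat d_{Z,H}(\Gamma_f,\Gamma_g)$ and $\widehat\rho_s(f,g)=\sup_{x\in X}\widehat d_Y(f(x),g(x))$. - $\widehat\rho_b(f,g)$ is the infimum of all $\varepsilon>0$ such that for every $x\in X$ there are $x',x''\in B_x(\varepsilon)$ with $\widehat d_Y(f(x),g(x'))<\varepsilon$ and $\widehat d_Y(g(x),f(x''))<\varepsilon$. - If $f\ne g$, $\widehat\rho_u(f,g)$ is the infimum of all $\varepsilon>0$ for which there exists $\delta>0$ such that $\sup_{x'\in B_x(\delta)}\widehat d_Y(f(x),g(x'))\le\varepsilon$ and $\sup_{x'\in B_x(\delta)}\widehat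 d_Y(g(x),f(x'))\le\varepsilon$ for all $x\in X$; and $\widehat\rho_u(f,f)=0$. A map $f$ is nonexpanding if $\widehat d_Y(f(x_1),f(x_2))\le\widehat d_X(x_1,x_2)$ for all $x_1,x_2\in X$. It is Lipschitz if there is a real $c\ge0$ with $\widehat d_Y(f(x_1),f(x_2))\le c\,\widehat d_X(x_1,x_2)$ for all $x_1,x_2\in X$; its dilatation is then $\operatorname{dil} f=\sup_{x_1\ne x_2}\widehat d_Y(f(x_1),f(x_2))/\widehat d_X(x_1,x_2)$ (a quotient with infinite denominator is read as $0$), and $\operatorname{dil} f=+\infty$ if $f$ is not Lipschitz. *)

theory Defs
  imports "HOL-Library.Extended_Nonnegative_Real" "HOL-Library.FuncSet"
begin

text \<open>
  Metrics take values in \<open>[0, \<infinity>]\<close>, rendered as \<^typ>\<open>ennreal\<close>; there the infimum of the empty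
  set is \<open>\<infinity>\<close> and its supremum is \<open>0\<close>. A space is a carrier set together with a distance
  function whose values off the carrier are irrelevant. The maps from \<open>X\<close> to \<open>Y\<close> are the
  extensional functions \<open>X \<rightarrow>\<^sub>E Y\<close>, so that equality of functions is equality on \<open>X\<close>.
\<close>

definition ext_metric_on :: "'a set \<Rightarrow> ('a \<Rightarrow> 'a \<Rightarrow> ennreal) \<Rightarrow> bool" where
  "ext_metric_on X d \<longleftrightarrow>
     (\<forall>x\<in>X. \<forall>y\<in>X. d x y = 0 \<longleftrightarrow> x = y) \<and>
     (\<forall>x\<in>X. \<forall>y\<in>X. d x y = d y x) \<and>
     (\<forall>x\<in>X. \<forall>y\<in>X. \<forall>z\<in>X. d x z \<le> d x y + d y z)"

definition nonarch_metric_on :: "'a set \<Rightarrow> ('a \<Rightarrow> 'a \<Rightarrow> ennreal) \<Rightarrow> bool" where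
  "nonarch_metric_on X d \<longleftrightarrow>
     ext_metric_on X d \<and> (\<forall>x\<in>X. \<forall>y\<in>X. \<forall>z\<in>X. d x z \<le> max (d x y) (d y z))"

definition ext_ball :: "'a set \<Rightarrow> ('a \<Rightarrow> 'a \<Rightarrow> ennreal) \<Rightarrow> 'a \<Rightarrow> ennreal \<Rightarrow> 'a set" where
  "ext_ball X d x r = {x' \<in> X. d x x' < r}"

definition dist_to_set :: "('a \<Rightarrow> 'a \<Rightarrow> ennreal) \<Rightarrow> 'a \<Rightarrow> 'a set \<Rightarrow> ennreal" where
  "dist_to_set d x A = (INF a\<in>A. d x a)"

definition hausdorff_dist :: "('a \<Rightarrow> 'a \<Rightarrow> ennreal) \<Rightarrow> 'a set \<Rightarrow> 'a set \<Rightarrow> ennreal" where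
  "hausdorff_dist d A B = max (SUP a\<in>A. dist_to_set d a B) (SUP b\<in>B. dist_to_set d b A)"

definition prod_dist ::
  "('a \<Rightarrow> 'a \<Rightarrow> ennreal) \<Rightarrow> ('b \<Rightarrow> 'b \<Rightarrow> ennreal) \<Rightarrow> 'a \<times> 'b \<Rightarrow> 'a \<times> 'b \<Rightarrow> ennreal" where
  "prod_dist dX dY p q = max (dX (fst p) (fst q)) (dY (snd p) (snd q))"

definition graph_on :: "'a set \<Rightarrow> ('a \<Rightarrow> 'b) \<Rightarrow> ('a \<times> 'b) set" where
  "graph_on X f = {(x, f x) | x. x \<in> X}"

definition rho_H ::
  "'a set \<Rightarrow> ('a \<Rightarrow> 'a \<Rightarrow> ennreal) \<Rightarrow> ('b \<Rightarrow> 'b \<Rightarrow> ennreal) \<Rightarrow> ('a \<Rightarrow> 'b) \<Rightarrow> ('a \<Rightarrow> 'b) \<Rightarrow> ennreal" where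
  "rho_H X dX dY f g = hausdorff_dist (prod_dist dX dY) (graph_on X f) (graph_on X g)"

definition rho_s :: "'a set \<Rightarrow> ('b \<Rightarrow> 'b \<Rightarrow> ennreal) \<Rightarrow> ('a \<Rightarrow> 'b) \<Rightarrow> ('a \<Rightarrow> 'b) \<Rightarrow> ennreal" where
  "rho_s X dY f g = (SUP x\<in>X. dY (f x) (g x))"

text \<open>The infima below range over finite positive \<open>\<epsilon>\<close>, and \<open>\<delta>\<close> is finite and positive as well.\<close>

definition rho_b ::
  "'a set \<Rightarrow> ('a \<Rightarrow> 'a \<Rightarrow> ennreal) \<Rightarrow> ('b \<Rightarrow> 'b \<Rightarrow> ennreal) \<Rightarrow> ('a \<Rightarrow> 'b) \<Rightarrow> ('a \<Rightarrow> 'b) \<Rightarrow> ennreal" where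
  "rho_b X dX dY f g = Inf {\<epsilon>. 0 < \<epsilon> \<and> \<epsilon> < \<infinity> \<and>
     (\<forall>x\<in>X. \<exists>x'\<in>ext_ball X dX x \<epsilon>. \<exists>x''\<in>ext_ball X dX x \<epsilon>.
        dY (f x) (g x') < \<epsilon> \<and> dY (g x) (f x'') < \<epsilon>)}"

definition rho_u ::
  "'a set \<Rightarrow> ('a \<Rightarrow> 'a \<Rightarrow> ennreal) \<Rightarrow> ('b \<Rightarrow> 'b \<Rightarrow> ennreal) \<Rightarrow> ('a \<Rightarrow> 'b) \<Rightarrow> ('a \<Rightarrow> 'b) \<Rightarrow> ennreal" where
  "rho_u X dX dY f g = (if f = g then 0 else Inf {\<epsilon>. 0 < \<epsilon> \<and> \<epsilon> < \<infinity> \<and>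
     (\<exists>\<delta>. 0 < \<delta> \<and> \<delta> < \<infinity> \<and> (\<forall>x\<in>X.
        (SUP x'\<in>ext_ball X dX x \<delta>. dY (f x) (g x')) \<le> \<epsilon> \<and>
        (SUP x'\<in>ext_ball X dX x \<delta>. dY (g x) (f x')) \<le> \<epsilon>))})"

definition nonexpanding_on ::
  "'a set \<Rightarrow> ('a \<Rightarrow> 'a \<Rightarrow> ennreal) \<Rightarrow> ('b \<Rightarrow> 'b \<Rightarrow> ennreal) \<Rightarrow> ('a \<Rightarrow> 'b) \<Rightarrow> bool" where
  "nonexpanding_on X dX dY f \<longleftrightarrow> (\<forall>x1\<in>X. \<forall>x2\<in>X. dY (f x1) (f x2) \<le> dX x1 x2)"

text \<open>
  In \<^typ>\<open>ennreal\<close>, \<open>0 * \<infinity> = 0\<close>; this convention does not affect which maps are Lipschitz, since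
  \<open>c\<close> may always be enlarged to be positive.
\<close>

definition ext_lipschitz_on ::
  "'a set \<Rightarrow> ('a \<Rightarrow> 'a \<Rightarrow> ennreal) \<Rightarrow> ('b \<Rightarrow> 'b \<Rightarrow> ennreal) \<Rightarrow> ('a \<Rightarrow> 'b) \<Rightarrow> bool" where
  "ext_lipschitz_on X dX dY f \<longleftrightarrow>
     (\<exists>c::real. 0 \<le> c \<and> (\<forall>x1\<in>X. \<forall>x2\<in>X. dY (f x1) (f x2) \<le> ennreal c * dX x1 x2))"

text \<open>
  Division in \<^typ>\<open>ennreal\<close> satisfies \<open>a / \<infinity> = 0\<close> for every \<open>a\<close>, including \<open>a = \<infinity>\<close>, as the
  definition of the dilatation requires.
\<close>

lemma ennreal_divide_infinity: "a / (\<infinity>::ennreal) = 0"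
  by (simp add: divide_ennreal_def)

definition dilatation ::
  "'a set \<Rightarrow> ('a \<Rightarrow> 'a \<Rightarrow> ennreal) \<Rightarrow> ('b \<Rightarrow> 'b \<Rightarrow> ennreal) \<Rightarrow> ('a \<Rightarrow> 'b) \<Rightarrow> ennreal" where
  "dilatation X dX dY f =
     (if ext_lipschitz_on X dX dY f
      then Sup {dY (f x1) (f x2) / dX x1 x2 | x1 x2. x1 \<in> X \<and> x2 \<in> X \<and> x1 \<noteq> x2}
      else \<infinity>)"

end

theory Submission
  imports Defs
begin

text \<open>
  The three distances are compared through their sublevel sets. A finite \<open>\<epsilon>\<close> above
  \<open>\<rho>\<^sub>H(f, g)\<close> means, up to passing between strict and weak bounds, that every point of either graph
  has a point of the other graph within \<open>\<epsilon>\<close> in both coordinates. This is also the condition whose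
  infimum is \<open>\<rho>\<^sub>b\<close>, which gives \<open>\<rho>\<^sub>H = \<rho>\<^sub>b\<close> (\<open>rho_H_eq_rho_b\<close>), by the density of the order of
  \<open>[0, \<infinity>]\<close>.

  The distance \<open>\<rho>\<^sub>u\<close> asks for more: \<open>g x'\<close> must be near \<open>f x\<close> for all \<open>x'\<close> near \<open>x\<close>, at some
  scale \<open>\<delta>\<close>. Choosing \<open>x' = x\<close> bounds \<open>d\<^sub>Y(f x, g x)\<close>, whence
  \<open>\<rho>\<^sub>H \<le> \<rho>\<^sub>s \<le> \<rho>\<^sub>u\<close>, and \<open>\<rho>\<^sub>u(f, g) = 0\<close> forces \<open>f = g\<close>. The strong triangle inequality for
  \<open>\<rho>\<^sub>u\<close> comes from that of \<open>Y\<close> by way of \<open>g x\<close>: the passage from \<open>f x\<close> to \<open>g x\<close> costs no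
  displacement in \<open>X\<close>, so the smaller of the two scales \<open>\<delta>\<close> works.

  The remaining two claims use that in a non-Archimedean \<open>Y\<close> errors do not add up. If \<open>\<epsilon>\<close> exceeds
  \<open>\<rho>\<^sub>H(f, g)\<close>, then \<open>g x\<close> is within \<open>\<epsilon>\<close> of some \<open>f x'\<close> with \<open>x'\<close> within \<open>\<epsilon>\<close> of \<open>x\<close>; if the
  dilatation of \<open>f\<close> is at most \<open>L \<ge> 1\<close>, then \<open>f x'\<close> is within \<open>L \<epsilon>\<close> of \<open>f x\<close>, so
  \<open>f x\<close> and \<open>g x\<close> are within the maximum \<open>L \<epsilon>\<close> of the two bounds
  (\<open>pointwise_close_if_graph_close\<close>). With \<open>L = 1\<close>, one more application of nonexpansion
  moves the argument of \<open>g\<close> by up to \<open>\<epsilon>\<close>, so that \<open>\<delta> = \<epsilon>\<close> serves in the definition of \<open>\<rho>\<^sub>u\<close>.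
\<close>

section \<open>Extended metrics\<close>

lemma ext_metric_on_self:
  "ext_metric_on X d \<Longrightarrow> x \<in> X \<Longrightarrow> d x x = 0"
  by (simp add: ext_metric_on_def)

lemma ext_metric_on_sym:
  "ext_metric_on X d \<Longrightarrow> x \<in> X \<Longrightarrow> y \<in> X \<Longrightarrow> d x y = d y x"
  by (simp add: ext_metric_on_def)

lemma nonarch_imp_ext_metric_on:
  "nonarch_metric_on X d \<Longrightarrow> ext_metric_on X d"
  by (simp add: nonarch_metric_on_def)

lemma nonarch_metric_on_triangle_le:
  assumes "nonarch_metric_on X d" "x \<in> X" "y \<in> X" "z \<in> X" "d x y \<le> r" "d y z \<le> r"
  shows "d x z \<le> r"
proof -
  have "d x z \<le> max (d x y) (d y z)"
    using assms by (simp add: nonarch_metric_on_def)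
  also have "\<dots> \<le> r" using assms by simp
  finally show ?thesis .
qed

lemma nonarch_metric_onI:
  fixes d :: "'a \<Rightarrow> 'a \<Rightarrow> ennreal"
  assumes "\<And>x y. x \<in> X \<Longrightarrow> y \<in> X \<Longrightarrow> d x y = 0 \<longleftrightarrow> x = y"
    and "\<And>x y. x \<in> X \<Longrightarrow> y \<in> X \<Longrightarrow> d x y = d y x"
    and strong: "\<And>x y z. x \<in> X \<Longrightarrow> y \<in> X \<Longrightarrow> z \<in> X \<Longrightarrow> d x z \<le> max (d x y) (d y z)"
  shows "nonarch_metric_on X d"
proof -
  have max_le: "max a b \<le> a + b" for a b :: ennreal
    by (simp add: add_increasing add_increasing2)
  have "d x z \<le> d x y + d y z" if "x \<in> X" "y \<in> X" "z \<in> X" for x y z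
    using strong[OF that] max_le order_trans by blast
  then show ?thesis
    using assms unfolding nonarch_metric_on_def ext_metric_on_def by blast
qed

section \<open>The Hausdorff distance of graphs\<close>

lemma hausdorff_dist_commute: "hausdorff_dist d A B = hausdorff_dist d B A"
  by (simp add: hausdorff_dist_def max.commute)

lemma rho_H_commute: "rho_H X dX dY f g = rho_H X dX dY g f"
  unfolding rho_H_def by (rule hausdorff_dist_commute)

lemma hausdorff_dist_lessD:
  assumes "hausdorff_dist d A B < r" "a \<in> A"
  shows "\<exists>b\<in>B. d a b < r"
proof -
  have "dist_to_set d a B \<le> hausdorff_dist d A B"
    unfolding hausdorff_dist_def using assms(2) by (intro max.coboundedI1 SUP_upper)
  then have "dist_to_set d a B < r" using assms(1) by (rule order_le_less_trans)
  then show ?thesis by (simp add: dist_to_set_def INF_less_iff)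
qed

lemma hausdorff_dist_leI:
  assumes "\<And>a. a \<in> A \<Longrightarrow> \<exists>b\<in>B. d a b \<le> r" "\<And>b. b \<in> B \<Longrightarrow> \<exists>a\<in>A. d b a \<le> r"
  shows "hausdorff_dist d A B \<le> r"
  unfolding hausdorff_dist_def dist_to_set_def using assms
  by (auto intro!: SUP_least intro: INF_lower2)

lemma rho_H_lessD:
  assumes "rho_H X dX dY f g < r" "x \<in> X"
  obtains x' where "x' \<in> X" "dX x x' < r" "dY (f x) (g x') < r"
proof -
  have "(x, f x) \<in> graph_on X f" using assms(2) by (auto simp: graph_on_def)
  from hausdorff_dist_lessD[OF assms(1)[unfolded rho_H_def] this]
  show ?thesis using that by (auto simp: graph_on_def prod_dist_def)
qed

lemma rho_H_leI:
  assumes "\<And>x. x \<in> X \<Longrightarrow> \<exists>x'\<in>X. dX x x' \<le> r \<and> dY (f x) (g x') \<le> r"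
    and "\<And>x. x \<in> X \<Longrightarrow> \<exists>x'\<in>X. dX x x' \<le> r \<and> dY (g x) (f x') \<le> r"
  shows "rho_H X dX dY f g \<le> r"
  unfolding rho_H_def
proof (rule hausdorff_dist_leI)
  fix a assume "a \<in> graph_on X f"
  then show "\<exists>b\<in>graph_on X g. prod_dist dX dY a b \<le> r"
    using assms(1) by (fastforce simp: graph_on_def prod_dist_def)
next
  fix b assume "b \<in> graph_on X g"
  then show "\<exists>a\<in>graph_on X f. prod_dist dX dY b a \<le> r"
    using assms(2) by (fastforce simp: graph_on_def prod_dist_def)
qed

text \<open>Vertical displacement is one way of moving from one graph to the other.\<close>

lemma rho_H_le_rho_s:
  assumes "ext_metric_on X dX" "ext_metric_on Y dY" "f \<in> X \<rightarrow> Y" "g \<in> X \<rightarrow> Y"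
  shows "rho_H X dX dY f g \<le> rho_s X dY f g"
proof (rule rho_H_leI)
  fix x assume x: "x \<in> X"
  then have fg: "dY (f x) (g x) \<le> rho_s X dY f g"
    unfolding rho_s_def by (rule SUP_upper)
  moreover have "dY (g x) (f x) = dY (f x) (g x)"
    using ext_metric_on_sym[OF assms(2)] assms(3,4) x by blast
  ultimately show "\<exists>x'\<in>X. dX x x' \<le> rho_s X dY f g \<and> dY (f x) (g x') \<le> rho_s X dY f g"
    and "\<exists>x'\<in>X. dX x x' \<le> rho_s X dY f g \<and> dY (g x) (f x') \<le> rho_s X dY f g"
    using x ext_metric_on_self[OF assms(1) x] by (auto intro!: bexI[of _ x])
qed

theorem rho_H_eq_rho_b: "rho_H X dX dY f g = rho_b X dX dY f g"
proof (rule antisym)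
  show "rho_H X dX dY f g \<le> rho_b X dX dY f g"
    unfolding rho_b_def
  proof (rule Inf_greatest, clarify)
    fix \<epsilon> :: ennreal
    assume *: "\<forall>x\<in>X. \<exists>x'\<in>ext_ball X dX x \<epsilon>. \<exists>x''\<in>ext_ball X dX x \<epsilon>.
      dY (f x) (g x') < \<epsilon> \<and> dY (g x) (f x'') < \<epsilon>"
    show "rho_H X dX dY f g \<le> \<epsilon>"
    proof (rule rho_H_leI)
      fix x assume "x \<in> X"
      with * obtain x' x'' where "x' \<in> X" "dX x x' < \<epsilon>" "dY (f x) (g x') < \<epsilon>"
        and "x'' \<in> X" "dX x x'' < \<epsilon>" "dY (g x) (f x'') < \<epsilon>"
        by (fastforce simp: ext_ball_def)
      then show "\<exists>x'\<in>X. dX x x' \<le> \<epsilon> \<and> dY (f x) (g x') \<le> \<epsilon>"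
        and "\<exists>x'\<in>X. dX x x' \<le> \<epsilon> \<and> dY (g x) (f x') \<le> \<epsilon>"
        by (meson less_imp_le)+
    qed
  qed
next
  show "rho_b X dX dY f g \<le> rho_H X dX dY f g"
  proof (rule dense_ge)
    fix \<epsilon> assume less: "rho_H X dX dY f g < \<epsilon>"
    show "rho_b X dX dY f g \<le> \<epsilon>"
    proof (cases "\<epsilon> < \<infinity>")
      case True
      have "\<exists>x'\<in>ext_ball X dX x \<epsilon>. \<exists>x''\<in>ext_ball X dX x \<epsilon>.
          dY (f x) (g x') < \<epsilon> \<and> dY (g x) (f x'') < \<epsilon>" if x: "x \<in> X" for x
      proof -
        obtain x' where "x' \<in> X" "dX x x' < \<epsilon>" "dY (f x) (g x') < \<epsilon>"
          using rho_H_lessD[OF less x] .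
        moreover obtain x'' where "x'' \<in> X" "dX x x'' < \<epsilon>" "dY (g x) (f x'') < \<epsilon>"
          using rho_H_lessD[OF less[unfolded rho_H_commute[of X dX dY f g]] x] .
        ultimately show ?thesis by (auto simp: ext_ball_def)
      qed
      moreover have "0 < \<epsilon>" using less by (rule order_le_less_trans[OF zero_le])
      ultimately show ?thesis
        unfolding rho_b_def using True by (intro Inf_lower) blast
    next
      case False
      then show ?thesis by (simp add: less_top[symmetric])
    qed
  qed
qed

section \<open>Locally uniform distance\<close>

lemma rho_u_self [simp]: "rho_u X dX dY f f = 0"
  by (simp add: rho_u_def)

lemma rho_u_commute: "rho_u X dX dY f g = rho_u X dX dY g f"
  by (auto simp: rho_u_def conj_commute)

lemma rho_u_leI:
  assumes "0 < \<epsilon>" "0 < \<delta>" "\<delta> < \<infinity>"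
    and "\<And>x x'. x \<in> X \<Longrightarrow> x' \<in> X \<Longrightarrow> dX x x' < \<delta> \<Longrightarrow> dY (f x) (g x') \<le> \<epsilon>"
    and "\<And>x x'. x \<in> X \<Longrightarrow> x' \<in> X \<Longrightarrow> dX x x' < \<delta> \<Longrightarrow> dY (g x) (f x') \<le> \<epsilon>"
  shows "rho_u X dX dY f g \<le> \<epsilon>"
proof (cases "f = g \<or> \<epsilon> = \<infinity>")
  case False
  then have "\<epsilon> < \<infinity>" by (simp add: less_top)
  with assms False show ?thesis
    unfolding rho_u_def
    by (auto intro!: Inf_lower exI[of _ \<delta>] SUP_least simp: ext_ball_def)
qed auto

text \<open>
  The hypothesis \<open>f \<noteq> g\<close> is essential: \<open>\<rho>\<^sub>u(f, f)\<close> vanishes by convention, even when \<open>f\<close> is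
  discontinuous and no \<open>\<delta>\<close> exists for small \<open>\<epsilon>\<close>.
\<close>

lemma rho_u_lessD:
  assumes "rho_u X dX dY f g < r" "f \<noteq> g"
  obtains \<epsilon> \<delta> where "0 < \<epsilon>" "\<epsilon> < r" "0 < \<delta>" "\<delta> < \<infinity>"
    "\<And>x x'. x \<in> X \<Longrightarrow> x' \<in> X \<Longrightarrow> dX x x' < \<delta> \<Longrightarrow> dY (f x) (g x') \<le> \<epsilon>"
    "\<And>x x'. x \<in> X \<Longrightarrow> x' \<in> X \<Longrightarrow> dX x x' < \<delta> \<Longrightarrow> dY (g x) (f x') \<le> \<epsilon>"
proof -
  obtain \<epsilon> \<delta> where "0 < \<epsilon>" "\<epsilon> < r" "0 < \<delta>" "\<delta> < \<infinity>" and
    *: "\<forall>x\<in>X. (SUP x'\<in>ext_ball X dX x \<delta>. dY (f x) (g x')) \<le> \<epsilon> \<and>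
        (SUP x'\<in>ext_ball X dX x \<delta>. dY (g x) (f x')) \<le> \<epsilon>"
    using assms unfolding rho_u_def by (auto simp: Inf_less_iff)
  then show ?thesis using that[of \<epsilon> \<delta>] by (auto simp: ext_ball_def SUP_le_iff)
qed

lemma rho_s_le_rho_u:
  assumes "ext_metric_on X dX" "ext_metric_on Y dY" "f \<in> X \<rightarrow> Y"
  shows "rho_s X dY f g \<le> rho_u X dX dY f g"
proof (cases "f = g")
  case True
  have "dY (f x) (f x) = 0" if "x \<in> X" for x
    using ext_metric_on_self[OF assms(2)] assms(3) that by blast
  with True show ?thesis unfolding rho_s_def by (intro SUP_least) simp
next
  case False
  show ?thesis
  proof (rule dense_ge)
    fix r assume "rho_u X dX dY f g < r"
    then obtain \<epsilon> \<delta> where \<epsilon>: "\<epsilon> < r" "0 < \<delta>"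
      "\<And>x x'. x \<in> X \<Longrightarrow> x' \<in> X \<Longrightarrow> dX x x' < \<delta> \<Longrightarrow> dY (f x) (g x') \<le> \<epsilon>"
      using False rho_u_lessD by metis
    show "rho_s X dY f g \<le> r"
      unfolding rho_s_def
    proof (rule SUP_least)
      fix x assume x: "x \<in> X"
      then have "dX x x < \<delta>" using ext_metric_on_self[OF assms(1)] \<epsilon>(2) by simp
      then show "dY (f x) (g x) \<le> r" using \<epsilon> x by (meson less_imp_le order_trans)
    qed
  qed
qed

lemma rho_s_eq_0_imp_eq:
  assumes "ext_metric_on Y dY" "f \<in> X \<rightarrow>\<^sub>E Y" "g \<in> X \<rightarrow>\<^sub>E Y" "rho_s X dY f g = 0"
  shows "f = g"
proof (rule PiE_ext[OF assms(2,3)])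
  fix x assume x: "x \<in> X"
  have "dY (f x) (g x) \<le> rho_s X dY f g"
    unfolding rho_s_def using x by (rule SUP_upper)
  then have "dY (f x) (g x) = 0" using assms(4) by simp
  moreover have "f x \<in> Y" "g x \<in> Y" using assms(2,3) x by auto
  ultimately show "f x = g x" using assms(1) by (simp add: ext_metric_on_def)
qed

text \<open>
  The intermediate point between \<open>f x\<close> and \<open>h x'\<close> is \<open>g x\<close>. Since \<open>x\<close> lies in each ball around
  itself, the first step may stay above \<open>x\<close>, and the whole displacement from \<open>x\<close> to \<open>x'\<close> falls
  to the second.
\<close>

lemma rho_u_strong_triangle:
  assumes X: "ext_metric_on X dX" and Y: "nonarch_metric_on Y dY"
    and "f \<in> X \<rightarrow> Y" "g \<in> X \<rightarrow> Y" "h \<in> X \<rightarrow> Y"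
  shows "rho_u X dX dY f h \<le> max (rho_u X dX dY f g) (rho_u X dX dY g h)"
proof (cases "f = g \<or> g = h")
  case True
  then show ?thesis by auto
next
  case False
  show ?thesis
  proof (rule dense_ge)
    fix r assume "max (rho_u X dX dY f g) (rho_u X dX dY g h) < r"
    then have less: "rho_u X dX dY f g < r" "rho_u X dX dY g h < r" by simp_all
    obtain \<epsilon>1 \<delta>1 where 1: "\<epsilon>1 < r" "0 < \<delta>1" "\<delta>1 < \<infinity>"
      "\<And>x x'. x \<in> X \<Longrightarrow> x' \<in> X \<Longrightarrow> dX x x' < \<delta>1 \<Longrightarrow> dY (f x) (g x') \<le> \<epsilon>1"
      "\<And>x x'. x \<in> X \<Longrightarrow> x' \<in> X \<Longrightarrow> dX x x' < \<delta>1 \<Longrightarrow> dY (g x) (f x') \<le> \<epsilon>1"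
      using rho_u_lessD[OF less(1)] False by metis
    obtain \<epsilon>2 \<delta>2 where 2: "\<epsilon>2 < r" "0 < \<delta>2" "\<delta>2 < \<infinity>"
      "\<And>x x'. x \<in> X \<Longrightarrow> x' \<in> X \<Longrightarrow> dX x x' < \<delta>2 \<Longrightarrow> dY (g x) (h x') \<le> \<epsilon>2"
      "\<And>x x'. x \<in> X \<Longrightarrow> x' \<in> X \<Longrightarrow> dX x x' < \<delta>2 \<Longrightarrow> dY (h x) (g x') \<le> \<epsilon>2"
      using rho_u_lessD[OF less(2)] False by metis
    have r: "0 < r" using less(1) by (rule order_le_less_trans[OF zero_le])
    show "rho_u X dX dY f h \<le> r"
    proof (rule rho_u_leI[where \<delta> = "min \<delta>1 \<delta>2"])
      fix x x' assume x: "x \<in> X" "x' \<in> X" "dX x x' < min \<delta>1 \<delta>2"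
      have self: "dX x x < \<delta>1" "dX x x < \<delta>2"
        using ext_metric_on_self[OF X x(1)] 1(2) 2(2) by simp_all
      have Yx: "f x \<in> Y" "g x \<in> Y" "h x \<in> Y" "f x' \<in> Y" "h x' \<in> Y"
        using assms(3-5) x by auto
      have "dY (f x) (g x) \<le> r" "dY (g x) (h x') \<le> r"
        using 1(4)[OF x(1,1) self(1)] 1(1) 2(4)[OF x(1,2)] 2(1) x(3) by auto
      then show "dY (f x) (h x') \<le> r"
        using nonarch_metric_on_triangle_le[OF Y] Yx by blast
      have "dY (h x) (g x) \<le> r" "dY (g x) (f x') \<le> r"
        using 2(5)[OF x(1,1) self(2)] 2(1) 1(5)[OF x(1,2)] 1(1) x(3) by auto
      then show "dY (h x) (f x') \<le> r"
        using nonarch_metric_on_triangle_le[OF Y] Yx by blast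
    qed (use r 1(2,3) 2(2) in \<open>auto simp: min_less_iff_disj\<close>)
  qed
qed

theorem nonarch_metric_on_rho_u:
  assumes X: "ext_metric_on X dX" and Y: "nonarch_metric_on Y dY"
  shows "nonarch_metric_on (X \<rightarrow>\<^sub>E Y) (rho_u X dX dY)"
proof (rule nonarch_metric_onI)
  fix f g assume fg: "f \<in> X \<rightarrow>\<^sub>E Y" "g \<in> X \<rightarrow>\<^sub>E Y"
  note Y' = nonarch_imp_ext_metric_on[OF Y]
  show "rho_u X dX dY f g = 0 \<longleftrightarrow> f = g"
  proof
    assume "rho_u X dX dY f g = 0"
    then have "rho_s X dY f g = 0"
      using rho_s_le_rho_u[OF X Y', of f g] fg(1) by (auto simp: PiE_def)
    then show "f = g" by (rule rho_s_eq_0_imp_eq[OF Y' fg])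
  qed simp
  show "rho_u X dX dY f g = rho_u X dX dY g f" by (rule rho_u_commute)
next
  fix f g h assume "f \<in> X \<rightarrow>\<^sub>E Y" "g \<in> X \<rightarrow>\<^sub>E Y" "h \<in> X \<rightarrow>\<^sub>E Y"
  then show "rho_u X dX dY f h \<le> max (rho_u X dX dY f g) (rho_u X dX dY g h)"
    by (intro rho_u_strong_triangle[OF X Y]) (auto simp: PiE_def)
qed

section \<open>Lipschitz maps\<close>

text \<open>
  A graph that comes \<open>\<epsilon>\<close>-close to \<open>(x, g x)\<close> at \<open>(x', f x')\<close> is followed back to \<open>(x, f x)\<close>; the
  error of this second step, at most \<open>L \<epsilon>\<close>, absorbs the first one because \<open>L \<ge> 1\<close>.
\<close>

lemma pointwise_close_if_graph_close:
  assumes Y: "nonarch_metric_on Y dY" and fg: "f \<in> X \<rightarrow> Y" "g \<in> X \<rightarrow> Y"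
    and L: "1 \<le> L"
    and lip: "\<And>x x'. x \<in> X \<Longrightarrow> x' \<in> X \<Longrightarrow> dY (f x) (f x') \<le> L * dX x x'"
    and less: "rho_H X dX dY f g < \<epsilon>" and x: "x \<in> X"
  shows "dY (f x) (g x) \<le> L * \<epsilon>"
proof -
  obtain x' where x': "x' \<in> X" "dX x x' < \<epsilon>" "dY (g x) (f x') < \<epsilon>"
    using rho_H_lessD[OF less[unfolded rho_H_commute[of X dX dY f g]] x] .
  have mem: "f x \<in> Y" "g x \<in> Y" "f x' \<in> Y" using fg x x'(1) by auto
  have "dY (f x) (f x') \<le> L * dX x x'" by (rule lip[OF x x'(1)])
  also have "\<dots> \<le> L * \<epsilon>" using x'(2) by (intro mult_left_mono) auto
  finally have 1: "dY (f x) (f x') \<le> L * \<epsilon>" .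
  have "dY (f x') (g x) \<le> 1 * \<epsilon>"
    using x'(3) ext_metric_on_sym[OF nonarch_imp_ext_metric_on[OF Y] mem(2,3)] by simp
  also have "\<dots> \<le> L * \<epsilon>" using L by (rule mult_right_mono) simp
  finally have "dY (f x') (g x) \<le> L * \<epsilon>" .
  with 1 show ?thesis using nonarch_metric_on_triangle_le[OF Y] mem by blast
qed

text \<open>
  Nonexpanding maps do not magnify a displacement of the argument, so closeness at scale \<open>\<epsilon>\<close> is
  automatically uniform on balls of radius \<open>\<epsilon>\<close>.
\<close>

theorem rho_u_le_rho_H_if_nonexpanding:
  assumes Y: "nonarch_metric_on Y dY" and fg: "f \<in> X \<rightarrow> Y" "g \<in> X \<rightarrow> Y"
    and ne: "nonexpanding_on X dX dY f" "nonexpanding_on X dX dY g"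
  shows "rho_u X dX dY f g \<le> rho_H X dX dY f g"
proof (rule dense_ge)
  fix \<epsilon> assume less: "rho_H X dX dY f g < \<epsilon>"
  show "rho_u X dX dY f g \<le> \<epsilon>"
  proof (cases "\<epsilon> = \<infinity>")
    case False
    have "0 < \<epsilon>" using less by (rule order_le_less_trans[OF zero_le])
    then show ?thesis
    proof (rule rho_u_leI)
      show "0 < \<epsilon>" by fact
      show "\<epsilon> < \<infinity>" using False by (simp add: less_top)
      fix x x' assume x: "x \<in> X" "x' \<in> X" "dX x x' < \<epsilon>"
      have mem: "f x \<in> Y" "g x \<in> Y" "f x' \<in> Y" "g x' \<in> Y" using fg x by auto
      have "dY (f x) (g x) \<le> 1 * \<epsilon>"
        by (rule pointwise_close_if_graph_close[OF Y fg _ _ less x(1)])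
          (use ne in \<open>auto simp: nonexpanding_on_def\<close>)
      then have close: "dY (f x) (g x) \<le> \<epsilon>" "dY (g x) (f x) \<le> \<epsilon>"
        using ext_metric_on_sym[OF nonarch_imp_ext_metric_on[OF Y] mem(1,2)] by simp_all
      have moved: "dY (f x) (f x') \<le> \<epsilon>" "dY (g x) (g x') \<le> \<epsilon>"
        using ne x by (meson nonexpanding_on_def less_imp_le order_trans)+
      show "dY (f x) (g x') \<le> \<epsilon>" "dY (g x) (f x') \<le> \<epsilon>"
        using nonarch_metric_on_triangle_le[OF Y] mem close moved by blast+
    qed
  qed simp
qed

lemma dilatation_finite_iff: "dilatation X dX dY f < \<infinity> \<longleftrightarrow> ext_lipschitz_on X dX dY f"
  if "ext_metric_on X dX"
proof
  assume "ext_lipschitz_on X dX dY f"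
  then obtain c :: real where
    c: "\<And>x1 x2. x1 \<in> X \<Longrightarrow> x2 \<in> X \<Longrightarrow> dY (f x1) (f x2) \<le> ennreal c * dX x1 x2"
    by (auto simp: ext_lipschitz_on_def)
  have "dY (f x1) (f x2) / dX x1 x2 \<le> ennreal c" if x: "x1 \<in> X" "x2 \<in> X" "x1 \<noteq> x2" for x1 x2
  proof -
    have "0 < dX x1 x2"
      using \<open>ext_metric_on X dX\<close> x by (auto simp: ext_metric_on_def zero_less_iff_neq_zero)
    then show ?thesis using c[OF x(1,2)]
      by (intro divide_le_posI_ennreal) (simp_all add: mult.commute)
  qed
  then have "dilatation X dX dY f \<le> ennreal c"
    using \<open>ext_lipschitz_on X dX dY f\<close> by (auto simp: dilatation_def intro!: Sup_least)
  then show "dilatation X dX dY f < \<infinity>"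
    using ennreal_less_top by (simp add: order_le_less_trans)
qed (auto simp: dilatation_def split: if_splits)

text \<open>
  The dilatation ignores pairs at infinite distance, so that a map between spaces whose points are
  at infinite distance from each other may have dilatation \<open>0\<close> without being constant. As
  \<open>0 * \<infinity> = 0\<close>, the dilatation has to be positive to serve as a Lipschitz constant on such pairs.
\<close>

lemma dist_le_dilatation:
  assumes X: "ext_metric_on X dX" and Y: "ext_metric_on Y dY" and f: "f \<in> X \<rightarrow> Y"
    and pos: "0 < dilatation X dX dY f" and x: "x1 \<in> X" "x2 \<in> X"
  shows "dY (f x1) (f x2) \<le> dilatation X dX dY f * dX x1 x2"
proof -
  consider "x1 = x2" | "dX x1 x2 = \<infinity>" | "x1 \<noteq> x2" "dX x1 x2 \<noteq> \<infinity>" by blast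
  then show ?thesis
  proof cases
    case 1
    moreover have "f x2 \<in> Y" using f x(2) by auto
    ultimately show ?thesis using ext_metric_on_self[OF Y] by simp
  next
    case 2
    then show ?thesis using pos by (auto simp: ennreal_mult_top)
  next
    case 3
    then have nz: "dX x1 x2 \<noteq> 0" using X x by (auto simp: ext_metric_on_def)
    have "dY (f x1) (f x2) / dX x1 x2 \<le> dilatation X dX dY f"
      using x 3(1) by (auto simp: dilatation_def intro!: Sup_upper)
    then have "dY (f x1) (f x2) / dX x1 x2 * dX x1 x2 \<le> dilatation X dX dY f * dX x1 x2"
      by (rule mult_right_mono) simp
    moreover have "dY (f x1) (f x2) / dX x1 x2 * dX x1 x2 = dY (f x1) (f x2)"
      using nz 3(2) by (simp add: ennreal_divide_times less_top[symmetric])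
    ultimately show ?thesis by simp
  qed
qed

text \<open>
  Finiteness of the dilatation is what allows the limit \<open>\<epsilon> \<rightarrow> \<rho>\<^sub>H(f, g)\<close> in \<open>L \<epsilon>\<close>: when
  \<open>\<rho>\<^sub>H(f, g) = 0\<close>, multiplication by \<open>\<infinity>\<close> is discontinuous there.
\<close>

lemma rho_s_le_dilatation_rho_H:
  assumes X: "ext_metric_on X dX" and Y: "nonarch_metric_on Y dY"
    and fg: "f \<in> X \<rightarrow> Y" "g \<in> X \<rightarrow> Y"
    and L: "1 \<le> dilatation X dX dY f" "dilatation X dX dY f < \<infinity>"
  shows "rho_s X dY f g \<le> dilatation X dX dY f * rho_H X dX dY f g"
  unfolding rho_s_def
proof (rule SUP_least)
  fix x assume x: "x \<in> X"
  let ?L = "dilatation X dX dY f"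
  have pos: "0 < ?L" using L(1) by (rule order_less_le_trans[OF zero_less_one])
  have "dY (f x) (g x) / ?L \<le> rho_H X dX dY f g"
  proof (rule dense_ge)
    fix \<epsilon> assume less: "rho_H X dX dY f g < \<epsilon>"
    have "dY (f x) (g x) \<le> ?L * \<epsilon>"
      by (rule pointwise_close_if_graph_close[OF Y fg L(1) _ less x])
        (rule dist_le_dilatation[OF X nonarch_imp_ext_metric_on[OF Y] fg(1) pos])
    then show "dY (f x) (g x) / ?L \<le> \<epsilon>"
      using pos by (intro divide_le_posI_ennreal) (simp_all add: mult.commute)
  qed
  then have "dY (f x) (g x) / ?L * ?L \<le> rho_H X dX dY f g * ?L"
    by (rule mult_right_mono) simp
  moreover have "dY (f x) (g x) / ?L * ?L = dY (f x) (g x)"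
    using pos L(2) by (simp add: ennreal_divide_times)
  ultimately show "dY (f x) (g x) \<le> ?L * rho_H X dX dY f g"
    by (simp add: mult.commute)
qed

lemma rho_s_commute:
  assumes "ext_metric_on Y dY" "f \<in> X \<rightarrow> Y" "g \<in> X \<rightarrow> Y"
  shows "rho_s X dY f g = rho_s X dY g f"
  unfolding rho_s_def
  by (rule SUP_cong) (use assms in \<open>auto intro!: ext_metric_on_sym[OF assms(1)]\<close>)

theorem rho_s_le_min_dilatation_rho_H:
  assumes X: "ext_metric_on X dX" and Y: "nonarch_metric_on Y dY"
    and fg: "f \<in> X \<rightarrow> Y" "g \<in> X \<rightarrow> Y"
    and lip: "ext_lipschitz_on X dX dY f \<or> ext_lipschitz_on X dX dY g"
    and L: "1 \<le> min (dilatation X dX dY f) (dilatation X dX dY g)"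
  shows "rho_s X dY f g
    \<le> min (dilatation X dX dY f) (dilatation X dX dY g) * rho_H X dX dY f g"
proof -
  have fin: "min (dilatation X dX dY f) (dilatation X dX dY g) < \<infinity>"
    using lip dilatation_finite_iff[OF X, of dY] by (auto simp: min_less_iff_disj)
  show ?thesis
  proof (cases "dilatation X dX dY f \<le> dilatation X dX dY g")
    case True
    then show ?thesis
      using rho_s_le_dilatation_rho_H[OF X Y fg] L fin by (simp add: min_def)
  next
    case False
    then show ?thesis
      using rho_s_le_dilatation_rho_H[OF X Y fg(2,1)] L fin
        rho_s_commute[OF nonarch_imp_ext_metric_on[OF Y] fg] rho_H_commute[of X dX dY f g]
      by (simp add: min_def)
  qed
qed

section \<open>Comparison of the distances\<close>

theorem theorem3p5:
  fixes X :: "'a set" and Y :: "'b set"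
    and dX :: "'a \<Rightarrow> 'a \<Rightarrow> ennreal" and dY :: "'b \<Rightarrow> 'b \<Rightarrow> ennreal"
  assumes "nonarch_metric_on X dX" and "nonarch_metric_on Y dY"
  shows "nonarch_metric_on (X \<rightarrow>\<^sub>E Y) (rho_u X dX dY) \<and>
    (\<forall>f \<in> X \<rightarrow>\<^sub>E Y. \<forall>g \<in> X \<rightarrow>\<^sub>E Y.
       rho_H X dX dY f g \<le> rho_u X dX dY f g \<and>
       (nonexpanding_on X dX dY f \<and> nonexpanding_on X dX dY g \<longrightarrow>
          rho_H X dX dY f g = rho_u X dX dY f g)) \<and>
    (\<forall>f \<in> X \<rightarrow>\<^sub>E Y. \<forall>g \<in> X \<rightarrow>\<^sub>E Y.
       rho_H X dX dY f g = rho_b X dX dY f g \<and>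
       ((ext_lipschitz_on X dX dY f \<or> ext_lipschitz_on X dX dY g) \<and>
          1 \<le> min (dilatation X dX dY f) (dilatation X dX dY g) \<longrightarrow>
          rho_s X dY f g
            \<le> min (dilatation X dX dY f) (dilatation X dX dY g) * rho_H X dX dY f g))"
proof (intro conjI ballI impI)
  note X = nonarch_imp_ext_metric_on[OF assms(1)]
  note Y = nonarch_imp_ext_metric_on[OF assms(2)]
  show "nonarch_metric_on (X \<rightarrow>\<^sub>E Y) (rho_u X dX dY)"
    by (rule nonarch_metric_on_rho_u[OF X assms(2)])
  fix f g assume "f \<in> X \<rightarrow>\<^sub>E Y" "g \<in> X \<rightarrow>\<^sub>E Y"
  then have fg: "f \<in> X \<rightarrow> Y" "g \<in> X \<rightarrow> Y" by (auto simp: PiE_def)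
  show le: "rho_H X dX dY f g \<le> rho_u X dX dY f g"
    using rho_H_le_rho_s[OF X Y fg] rho_s_le_rho_u[OF X Y fg(1)] by (rule order_trans)
  show "rho_H X dX dY f g = rho_b X dX dY f g" by (rule rho_H_eq_rho_b)
  show "rho_H X dX dY f g = rho_u X dX dY f g"
    if "nonexpanding_on X dX dY f \<and> nonexpanding_on X dX dY g"
    using le rho_u_le_rho_H_if_nonexpanding[OF assms(2) fg] that by (intro antisym) auto
  show "rho_s X dY f g
      \<le> min (dilatation X dX dY f) (dilatation X dX dY g) * rho_H X dX dY f g"
    if "(ext_lipschitz_on X dX dY f \<or> ext_lipschitz_on X dX dY g) \<and>
      1 \<le> min (dilatation X dX dY f) (dilatation X dX dY g)"
    using rho_s_le_min_dilatation_rho_H[OF X assms(2) fg] that by blast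
qed

end
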